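(* The Cartan canonical $\Gamma$-linear connection $C\Gamma$ of the jet conformal Minkowski metric $F$ has a single effective local torsion d-tensor (all the other adapted local components of torsion vanish), namely $$R_{(1)jk}^{(l)}=\mathfrak{R}_{pjk}^l\,y_1^p,$$ where $$\begin{aligned}\mathfrak{R}_{ijk}^l={}&\delta_j^l(\sigma_{ik}-\sigma_i\sigma_k)-\delta_k^l(\sigma_{ij}-\sigma_i\sigma_j)\\&+(1-\delta_{ij})(\sigma_{lk}-\sigma_l\sigma_k)-(1-\delta_{ik})(\sigma_{lj}-\sigma_l\sigma_j)\\&+\tfrac13(\operatorname{div}D_\sigma)\left(\sigma_k-\sigma_j+\delta_{ik}\sigma_j-\delta_{ij}\sigma_k\right)\\&+\left[\|\operatorname{grad}\sigma\|^2-\tfrac13(\operatorname{div}D_\sigma)^2\right]\left(\delta_k^l-\delta_j^l+\delta_{ik}\delta_j^l-\delta_{ij}\delta_k^l\right)\\&+\tfrac13\left[(\operatorname{div}D_\sigma)_j-(\operatorname{div}D_\sigma)_k+\delta_{ij}(\operatorname{div}D_\sigma)_k-\delta_{ik}(\operatorname{div}D_\sigma)_j\right].\end{aligned}$$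
   Context: $h_{11}(t)>0$ is a smooth Riemannian metric on $\mathbb{R}$, $h^{11}=1/h_{11}$, and $\varkappa_{11}^1=\frac{h^{11}}{2}\frac{dh_{11}}{dt}$. $M^4$ is a smooth 4-manifold with local coordinates $x=(x^1,\dots,x^4)$, and $\sigma$ is a smooth non-constant function on $M^4$. The 1-jet space $J^1(\mathbb{R},M^4)$ has local coordinates $(t,x,y)$, $y=(y_1^1,\dots,y_1^4)$. The jet conformal Minkowski metric is $F(t,x,y)=e^{\sigma(x)}\sqrt{h^{11}(t)}\sqrt{G_{11}(y)}$ with $G_{11}(y)=y_1^1y_1^2+y_1^1y_1^3+y_1^1y_1^4+y_1^2y_1^3+y_1^2y_1^4+y_1^3y_1^4$, on the domain $G_{11}(y)>0$. Latin indices run from 1 to 4, the Einstein summation convention is used for an index repeated in upper and lower position, and $\delta^i_j,\delta_{ij}$ are Kronecker symbols. Notation: $\sigma_i=\partial\sigma/\partial x^i$, $\sigma_{ij}=\partial^2\sigma/\partial x^i\partial x^j$, $\|\operatorname{grad}\sigma\|^2=\sigma_1^2+\sigma_2^2+\sigma_3^2+\sigma_4^2$, $\operatorname{div}D_\sigma=\sigma_1+\sigma_2+\sigma_3+\sigma_4$, $(\operatorname{div}D_\sigma)_i=\partial(\operatorname{div}D_\sigma)/\partial x^i=\sigma_{1i}+\sigma_{2i}+\sigma_{3i}+\sigma_{4i}$, $S_{[1]1}=y_1^1+y_1^2+y_1^3+y_1^4$. The canonical nonlinear connection of $F$ has components $M_{(1)1}^{(i)}=-\varkappa_{11}^1y_1^i$,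 $N_{(1)j}^{(i)}=\sigma_jy_1^i+\sigma_my_1^m\delta_j^i+[\sigma_i-\frac13\operatorname{div}D_\sigma](S_{[1]1}-y_1^j)$, and the adapted basis of vector fields is $\frac{\delta}{\delta t}=\frac{\partial}{\partial t}+\varkappa_{11}^1y_1^p\frac{\partial}{\partial y_1^p}$, $\frac{\delta}{\delta x^i}=\frac{\partial}{\partial x^i}-N_{(1)i}^{(p)}\frac{\partial}{\partial y_1^p}$, $\frac{\partial}{\partial y_1^i}$. The Cartan canonical connection $C\Gamma$ has adapted components $(\varkappa_{11}^1,\ G_{j1}^k=0,\ L_{jk}^i,\ C_{j(k)}^{i(1)}=0)$ with $L_{jk}^i=\delta_j^i\sigma_k+\delta_k^i\sigma_j+(1-\delta_{jk})\sigma_i-\frac{1-\delta_{jk}}{3}\operatorname{div}D_\sigma$; that is, it is the linear connection $\nabla$ on $J^1(\mathbb{R},M^4)$ given by $$\nabla_{\frac{\delta}{\delta t}}\tfrac{\delta}{\delta t}=\varkappa_{11}^1\tfrac{\delta}{\delta t},\quad\nabla_{\frac{\delta}{\delta t}}\tfrac{\delta}{\delta x^j}=0,\quad\nabla_{\frac{\delta}{\delta t}}\tfrac{\partial}{\partial y_1^j}=-\varkappa_{11}^1\tfrac{\partial}{\partial y_1^j},$$ $$\nabla_{\frac{\delta}{\delta x^k}}\tfrac{\delta}{\delta t}=0,\quad\nabla_{\frac{\delta}{\delta x^k}}\tfrac{\delta}{\delta x^j}=L_{jk}^i\tfrac{\delta}{\delta x^i},\quad\nabla_{\frac{\delta}{\delta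 x^k}}\tfrac{\partial}{\partial y_1^j}=L_{jk}^i\tfrac{\partial}{\partial y_1^i},$$ and $\nabla_{\frac{\partial}{\partial y_1^k}}$ annihilates all adapted basis fields. Its torsion is $T(X,Y)=\nabla_XY-\nabla_YX-[X,Y]$; the torsion d-tensors are the components of $T$ in the adapted basis. The component $R_{(1)jk}^{(l)}$ is the one defined by $T\left(\frac{\delta}{\delta x^k},\frac{\delta}{\delta x^j}\right)=R_{(1)jk}^{(l)}\frac{\partial}{\partial y_1^l}$ (its only possible components being along $\partial/\partial y_1^l$), equivalently $R_{(1)jk}^{(l)}=\frac{\delta N_{(1)j}^{(l)}}{\delta x^k}-\frac{\delta N_{(1)k}^{(l)}}{\delta x^j}$. "Effective" means not automatically zero; all remaining adapted torsion components are identically zero. *)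

theory Defs
  imports "HOL-Analysis.Analysis"
begin

section \<open>Smooth functions and smooth 4-manifolds\<close>

fun Ck_on :: "nat \<Rightarrow> 'a::real_normed_vector set \<Rightarrow> ('a \<Rightarrow> 'b::real_normed_vector) \<Rightarrow> bool" where
  "Ck_on 0 S f \<longleftrightarrow> continuous_on S f"
| "Ck_on (Suc n) S f \<longleftrightarrow>
     (\<forall>x\<in>S. f differentiable (at x)) \<and> (\<forall>v. Ck_on n S (\<lambda>x. frechet_derivative f (at x) v))"

text \<open>Meant for open \<open>S\<close> in a finite-dimensional space: the derivatives are the unrestricted
  ones, and continuity of all directional derivatives is then continuity of the differential.\<close>

definition smooth_on :: "'a::real_normed_vector set \<Rightarrow> ('a \<Rightarrow> 'b::real_normed_vector) \<Rightarrow> bool" where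
  "smooth_on S f \<longleftrightarrow> (\<forall>n. Ck_on n S f)"

type_synonym 'm chart = "'m set \<times> ('m \<Rightarrow> real^4)"

definition is_chart :: "'m::topological_space chart \<Rightarrow> bool" where
  "is_chart c \<longleftrightarrow> (case c of (U, \<phi>) \<Rightarrow>
     open U \<and> open (\<phi> ` U) \<and> homeomorphism U (\<phi> ` U) \<phi> (inv_into U \<phi>))"

text \<open>The manifold is the whole type \<open>'m\<close>; the type classes express that it is Hausdorff and
  second countable.\<close>

definition smooth_atlas :: "'m::{t2_space, second_countable_topology} chart set \<Rightarrow> bool" where
  "smooth_atlas A \<longleftrightarrow>
     (\<forall>c\<in>A. is_chart c) \<and> (\<Union>(U, \<phi>)\<in>A. U) = UNIV \<and>
     (\<forall>(U, \<phi>)\<in>A. \<forall>(V, \<psi>)\<in>A. smooth_on (\<phi> ` (U \<inter> V)) (\<psi> \<circ> inv_into U \<phi>))"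

definition smooth_function :: "'m::{t2_space, second_countable_topology} chart set \<Rightarrow> ('m \<Rightarrow> real) \<Rightarrow> bool" where
  "smooth_function A f \<longleftrightarrow> (\<forall>(U, \<phi>)\<in>A. smooth_on (\<phi> ` U) (f \<circ> inv_into U \<phi>))"

definition nonconstant_on :: "'a set \<Rightarrow> ('a \<Rightarrow> 'b) \<Rightarrow> bool" where
  "nonconstant_on S f \<longleftrightarrow> (\<exists>a\<in>S. \<exists>b\<in>S. f a \<noteq> f b)"


section \<open>Notation in local coordinates\<close>

text \<open>Below, \<open>s\<close> is the function \<open>\<sigma>\<close> expressed in the local coordinates \<open>x\<close>.\<close>

definition partial :: "4 \<Rightarrow> (real^4 \<Rightarrow> real) \<Rightarrow> real^4 \<Rightarrow> real" where
  "partial i f x = frechet_derivative f (at x) (axis i 1)"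

definition partial2 :: "4 \<Rightarrow> 4 \<Rightarrow> (real^4 \<Rightarrow> real) \<Rightarrow> real^4 \<Rightarrow> real" where
  "partial2 i j f = partial j (partial i f)"

definition kron :: "'a \<Rightarrow> 'a \<Rightarrow> real" where
  "kron i j = (if i = j then 1 else 0)"

definition grad_norm2 :: "(real^4 \<Rightarrow> real) \<Rightarrow> real^4 \<Rightarrow> real" where
  "grad_norm2 s x = (\<Sum>i\<in>UNIV. (partial i s x)\<^sup>2)"

definition divD :: "(real^4 \<Rightarrow> real) \<Rightarrow> real^4 \<Rightarrow> real" where
  "divD s x = (\<Sum>i\<in>UNIV. partial i s x)"

definition S1 :: "real^4 \<Rightarrow> real" where
  "S1 y = (\<Sum>i\<in>UNIV. y $ i)"

definition kappa :: "(real \<Rightarrow> real) \<Rightarrow> real \<Rightarrow> real" where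
  "kappa h t = (1 / h t) / 2 * deriv h t"


section \<open>The jet conformal Minkowski metric\<close>

text \<open>Local coordinates \<open>(t, x, y)\<close> of the 1-jet space over a coordinate neighbourhood;
  tangent vectors are written in the coordinate basis, hence have the same type.\<close>

type_synonym jet = "real \<times> (real^4) \<times> (real^4)"
type_synonym jet_field = "jet \<Rightarrow> jet"

definition jet_region :: "(real^4) set \<Rightarrow> jet set" where
  "jet_region V = UNIV \<times> V \<times> UNIV"

definition G11 :: "real^4 \<Rightarrow> real" where
  "G11 y = y$1 * y$2 + y$1 * y$3 + y$1 * y$4 + y$2 * y$3 + y$2 * y$4 + y$3 * y$4"

definition jet_conformal_Minkowski :: "(real \<Rightarrow> real) \<Rightarrow> (real^4 \<Rightarrow> real) \<Rightarrow> jet \<Rightarrow> real" where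
  "jet_conformal_Minkowski h s = (\<lambda>(t, x, y). exp (s x) * sqrt (1 / h t) * sqrt (G11 y))"

text \<open>The domain of this metric \<open>F\<close>. Its canonical nonlinear connection and its Cartan canonical
  connection are introduced below through their explicit local components; these are polynomial
  in \<open>y\<close> and hence make sense over all of \<open>jet_region\<close>, not only where \<open>0 < G11 y\<close>.\<close>

definition metric_domain :: "(real^4) set \<Rightarrow> jet set" where
  "metric_domain V = {(t, x, y) \<in> jet_region V. 0 < G11 y}"


section \<open>Canonical nonlinear connection and adapted bases\<close>

definition M_coeff :: "(real \<Rightarrow> real) \<Rightarrow> 4 \<Rightarrow> jet \<Rightarrow> real" where
  "M_coeff h i = (\<lambda>(t, x, y). - kappa h t * y $ i)"

text \<open>\<open>N_coeff s i j\<close> is the component with upper index \<open>i\<close> and lower index \<open>j\<close>; likewise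
  \<open>L_coeff s i j k\<close> and \<open>frakR s l i j k\<close> have the upper index first.\<close>

definition N_coeff :: "(real^4 \<Rightarrow> real) \<Rightarrow> 4 \<Rightarrow> 4 \<Rightarrow> jet \<Rightarrow> real" where
  "N_coeff s i j = (\<lambda>(t, x, y).
     partial j s x * y $ i + (\<Sum>m\<in>UNIV. partial m s x * y $ m) * kron i j
     + (partial i s x - 1/3 * divD s x) * (S1 y - y $ j))"

text \<open>Index set of the adapted basis: \<open>Time\<close> for \<open>\<delta>/\<delta>t\<close>, \<open>Horiz i\<close> for \<open>\<delta>/\<delta>x\<^sup>i\<close>, and
  \<open>Vert i\<close> for \<open>\<partial>/\<partial>y\<^sup>i\<close>.\<close>

datatype jet_index = Time | Horiz 4 | Vert 4

lemma UNIV_jet_index: "(UNIV :: jet_index set) = insert Time (range Horiz \<union> range Vert)"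
  using jet_index.exhaust by blast

instance jet_index :: finite
  by standard (simp add: UNIV_jet_index)

fun adapted :: "(real \<Rightarrow> real) \<Rightarrow> (real^4 \<Rightarrow> real) \<Rightarrow> jet_index \<Rightarrow> jet_field" where
  "adapted h s Time p = (1, 0, - (\<Sum>i\<in>UNIV. M_coeff h i p *\<^sub>R axis i 1))"
| "adapted h s (Horiz j) p = (0, axis j 1, - (\<Sum>i\<in>UNIV. N_coeff s i j p *\<^sub>R axis i 1))"
| "adapted h s (Vert i) p = (0, 0, axis i 1)"

text \<open>The dual coframe \<open>dt\<close>, \<open>dx\<^sup>i\<close>, \<open>\<delta>y\<^sup>i = dy\<^sup>i + M\<^sup>i dt + N\<^sup>i\<^sub>j dx\<^sup>j\<close>, i.e. the components of a
  tangent vector \<open>v\<close> at \<open>p\<close> in the adapted basis.\<close>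

fun coadapted :: "(real \<Rightarrow> real) \<Rightarrow> (real^4 \<Rightarrow> real) \<Rightarrow> jet_index \<Rightarrow> jet \<Rightarrow> jet \<Rightarrow> real" where
  "coadapted h s Time p v = fst v"
| "coadapted h s (Horiz i) p v = fst (snd v) $ i"
| "coadapted h s (Vert i) p v =
     snd (snd v) $ i + M_coeff h i p * fst v + (\<Sum>j\<in>UNIV. N_coeff s i j p * fst (snd v) $ j)"

lemma coadapted_adapted: "coadapted h s a p (adapted h s b p) = kron a b"
  by (cases a; cases b) (auto simp: kron_def axis_def sum_negf sum_distrib_left
      if_distrib[of "\<lambda>u. _ * u"] cong: if_cong)

section \<open>The Cartan canonical connection and its torsion\<close>

definition L_coeff :: "(real^4 \<Rightarrow> real) \<Rightarrow> 4 \<Rightarrow> 4 \<Rightarrow> 4 \<Rightarrow> jet \<Rightarrow> real" where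
  "L_coeff s i j k = (\<lambda>(t, x, y).
     kron i j * partial k s x + kron i k * partial j s x + (1 - kron j k) * partial i s x
     - (1 - kron j k) / 3 * divD s x)"

text \<open>\<open>cov_adapted h s b a\<close> is the covariant derivative of the adapted basis field with index \<open>a\<close>
  along the one with index \<open>b\<close>.\<close>

fun cov_adapted :: "(real \<Rightarrow> real) \<Rightarrow> (real^4 \<Rightarrow> real) \<Rightarrow> jet_index \<Rightarrow> jet_index \<Rightarrow> jet_field" where
  "cov_adapted h s Time Time p = kappa h (fst p) *\<^sub>R adapted h s Time p"
| "cov_adapted h s Time (Horiz j) p = 0"
| "cov_adapted h s Time (Vert j) p = - kappa h (fst p) *\<^sub>R adapted h s (Vert j) p"
| "cov_adapted h s (Horiz k) Time p = 0"
| "cov_adapted h s (Horiz k) (Horiz j) p = (\<Sum>i\<in>UNIV. L_coeff s i j k p *\<^sub>R adapted h s (Horiz i) p)"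
| "cov_adapted h s (Horiz k) (Vert j) p = (\<Sum>i\<in>UNIV. L_coeff s i j k p *\<^sub>R adapted h s (Vert i) p)"
| "cov_adapted h s (Vert k) a p = 0"

text \<open>The linear connection determined by these values: function-linear in \<open>X\<close>, additive and
  satisfying the Leibniz rule in \<open>Y\<close>.\<close>

definition nabla :: "(real \<Rightarrow> real) \<Rightarrow> (real^4 \<Rightarrow> real) \<Rightarrow> jet_field \<Rightarrow> jet_field \<Rightarrow> jet_field" where
  "nabla h s X Y p = (\<Sum>a\<in>UNIV.
     frechet_derivative (\<lambda>q. coadapted h s a q (Y q)) (at p) (X p) *\<^sub>R adapted h s a p
     + coadapted h s a p (Y p) *\<^sub>R
         (\<Sum>b\<in>UNIV. coadapted h s b p (X p) *\<^sub>R cov_adapted h s b a p))"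

lemma nabla_adapted: "nabla h s (adapted h s b) (adapted h s a) = cov_adapted h s b a"
proof
  fix p
  have kron_sum: "(\<Sum>c\<in>UNIV. kron c d *\<^sub>R f c) = f d" for d :: jet_index and f :: "jet_index \<Rightarrow> jet"
    by (simp add: kron_def if_distrib[of "\<lambda>u. u *\<^sub>R _"] cong: if_cong)
  show "nabla h s (adapted h s b) (adapted h s a) p = cov_adapted h s b a p"
    by (simp add: nabla_def coadapted_adapted kron_sum frechet_derivative_const)
qed

definition lie_bracket :: "jet_field \<Rightarrow> jet_field \<Rightarrow> jet_field" where
  "lie_bracket X Y p = frechet_derivative Y (at p) (X p) - frechet_derivative X (at p) (Y p)"

definition torsion :: "(real \<Rightarrow> real) \<Rightarrow> (real^4 \<Rightarrow> real) \<Rightarrow> jet_field \<Rightarrow> jet_field \<Rightarrow> jet_field" where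
  "torsion h s X Y p = nabla h s X Y p - nabla h s Y X p - lie_bracket X Y p"

text \<open>The component along the adapted basis field with index \<open>c\<close> of the torsion evaluated on those
  with indices \<open>a\<close> and \<open>b\<close>, in this order.\<close>

definition torsion_comp ::
    "(real \<Rightarrow> real) \<Rightarrow> (real^4 \<Rightarrow> real) \<Rightarrow> jet_index \<Rightarrow> jet_index \<Rightarrow> jet_index \<Rightarrow> jet \<Rightarrow> real" where
  "torsion_comp h s c a b p = coadapted h s c p (torsion h s (adapted h s a) (adapted h s b) p)"

text \<open>Note the order of the lower indices: \<open>R\<^sup>l\<^sub>j\<^sub>k\<close> is read off from \<open>T(\<delta>/\<delta>x\<^sup>k, \<delta>/\<delta>x\<^sup>j)\<close>.\<close>

definition R_torsion :: "(real \<Rightarrow> real) \<Rightarrow> (real^4 \<Rightarrow> real) \<Rightarrow> 4 \<Rightarrow> 4 \<Rightarrow> 4 \<Rightarrow> jet \<Rightarrow> real" where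
  "R_torsion h s l j k = torsion_comp h s (Vert l) (Horiz k) (Horiz j)"

definition frakR :: "(real^4 \<Rightarrow> real) \<Rightarrow> 4 \<Rightarrow> 4 \<Rightarrow> 4 \<Rightarrow> 4 \<Rightarrow> real^4 \<Rightarrow> real" where
  "frakR s l i j k x =
     kron l j * (partial2 i k s x - partial i s x * partial k s x)
     - kron l k * (partial2 i j s x - partial i s x * partial j s x)
     + (1 - kron i j) * (partial2 l k s x - partial l s x * partial k s x)
     - (1 - kron i k) * (partial2 l j s x - partial l s x * partial j s x)
     + 1/3 * divD s x *
         (partial k s x - partial j s x + kron i k * partial j s x - kron i j * partial k s x)
     + (grad_norm2 s x - 1/3 * (divD s x)\<^sup>2) *
         (kron l k - kron l j + kron i k * kron l j - kron i j * kron l k)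
     + 1/3 * (partial j (divD s) x - partial k (divD s) x
         + kron i j * partial k (divD s) x - kron i k * partial j (divD s) x)"

end

theory Submission
  imports Defs
begin

text \<open>Since \<open>L\<close> is symmetric in its lower indices, the torsion on two horizontal fields is minus
  their bracket, which is vertical with components \<open>\<delta>N\<^sup>l\<^sub>j/\<delta>x\<^sup>k - \<delta>N\<^sup>l\<^sub>k/\<delta>x\<^sup>j\<close>. The quadratic terms reduce
  to the two contractions \<open>\<Sum>\<^sub>p N\<^sup>p\<^sub>k\<close> and \<open>\<Sum>\<^sub>p \<sigma>\<^sub>p N\<^sup>p\<^sub>k\<close>, and the second-order terms need \<open>\<sigma>\<^sub>j\<^sub>k = \<sigma>\<^sub>k\<^sub>j\<close>.
  The remaining components vanish because \<open>N\<close> is independent of \<open>t\<close>, homogeneous of degree one in \<open>y\<close>,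
  and satisfies \<open>\<partial>N\<^sup>i\<^sub>k/\<partial>y\<^sup>j = L\<^sup>i\<^sub>j\<^sub>k\<close>. The function \<open>\<sigma> = x\<^sup>1\<close> shows that \<open>R\<close> is effective.\<close>

section \<open>Smooth functions and the symmetry of second derivatives\<close>

lemma Ck_on_const: "Ck_on n S (\<lambda>_. c)"
  by (induction n arbitrary: c) (auto simp: frechet_derivative_const)

text \<open>A bounded linear map is its own derivative at every point, so each directional
  derivative is a constant and \<open>Ck_on_const\<close> takes over after one step.\<close>

lemma smooth_on_bounded_linear:
  assumes "bounded_linear f"
  shows "smooth_on S f"
proof -
  have d: "(f has_derivative f) (at x)" for x
    using assms by (rule bounded_linear_imp_has_derivative)
  have "Ck_on n S f" for n
  proof (cases n)
    case 0
    then show ?thesis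
      using assms by (simp add: linear_continuous_on)
  next
    case (Suc m)
    then show ?thesis
      using d by (auto simp: frechet_derivative_at[OF d, symmetric] Ck_on_const differentiable_def)
  qed
  then show ?thesis by (simp add: smooth_on_def)
qed

lemma smooth_on_differentiable:
  assumes "smooth_on S f" "x \<in> S"
  shows "f differentiable (at x)"
proof -
  have "Ck_on (Suc 0) S f" using assms(1) by (simp add: smooth_on_def del: Ck_on.simps)
  then show ?thesis using assms(2) by simp
qed

lemma smooth_on_frechet_derivative:
  assumes "smooth_on S f"
  shows "smooth_on S (\<lambda>x. frechet_derivative f (at x) v)"
  unfolding smooth_on_def
proof
  fix n
  have "Ck_on (Suc n) S f" using assms by (simp add: smooth_on_def del: Ck_on.simps)
  then show "Ck_on n S (\<lambda>x. frechet_derivative f (at x) v)" by simp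
qed

lemma smooth_on_continuous_on: "smooth_on S f \<Longrightarrow> continuous_on S f"
  unfolding smooth_on_def by (metis Ck_on.simps(1))

text \<open>Restricts \<open>f\<close> to a line, so that the one-variable mean value theorem
  becomes available.\<close>

lemma directional_derivative:
  fixes f :: "'a::real_normed_vector \<Rightarrow> real"
  assumes "f differentiable (at (p + t *\<^sub>R u))"
  shows "((\<lambda>t. f (p + t *\<^sub>R u)) has_real_derivative frechet_derivative f (at (p + t *\<^sub>R u)) u) (at t)"
proof -
  let ?D = "frechet_derivative f (at (p + t *\<^sub>R u))"
  have D: "(f has_derivative ?D) (at (p + t *\<^sub>R u))"
    using assms frechet_derivative_works by blast
  have "((\<lambda>t. f (p + t *\<^sub>R u)) has_derivative (\<lambda>h. ?D (h *\<^sub>R u))) (at t)"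
    by (rule has_derivative_compose[where f = "\<lambda>t. p + t *\<^sub>R u", OF _ D])
      (auto intro!: derivative_eq_intros)
  moreover have "?D (h *\<^sub>R u) = ?D u * h" for h
    using D by (simp add: has_derivative_bounded_linear linear_simps bounded_linear.linear
        linear_scale mult.commute)
  ultimately show ?thesis
    by (simp add: has_field_derivative_def)
qed

text \<open>The second difference over the parallelogram spanned by \<open>r *\<^sub>R u\<close> and
  \<open>r *\<^sub>R v\<close> is the increment in direction \<open>u\<close> of a first difference
  in direction \<open>v\<close>. The mean value theorem, applied once in each direction, contributes
  one factor \<open>r\<close> each time.\<close>

lemma second_difference_mvt:
  fixes f :: "'a::real_normed_vector \<Rightarrow> real"
  assumes r: "0 < r"
    and mem: "\<And>a b. 0 \<le> a \<Longrightarrow> a \<le> r \<Longrightarrow> 0 \<le> b \<Longrightarrow> b \<le> r \<Longrightarrow> x + a *\<^sub>R u + b *\<^sub>R v \<in> S"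
    and f: "smooth_on S f"
  shows "\<exists>a b. 0 \<le> a \<and> a \<le> r \<and> 0 \<le> b \<and> b \<le> r \<and>
    f (x + r *\<^sub>R u + r *\<^sub>R v) - f (x + r *\<^sub>R u) - f (x + r *\<^sub>R v) + f x =
      r\<^sup>2 * frechet_derivative (\<lambda>z. frechet_derivative f (at z) u) (at (x + a *\<^sub>R u + b *\<^sub>R v)) v"
proof -
  let ?u = "\<lambda>z. frechet_derivative f (at z) u"
  define g where "g a = f (x + r *\<^sub>R v + a *\<^sub>R u) - f (x + a *\<^sub>R u)" for a
  have dg: "(g has_real_derivative ?u (x + r *\<^sub>R v + a *\<^sub>R u) - ?u (x + a *\<^sub>R u)) (at a)"
    if "0 \<le> a" "a \<le> r" for a
    unfolding g_def
    using that r mem[of a r] mem[of a 0] smooth_on_differentiable[OF f]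
    by (intro DERIV_diff directional_derivative) (auto simp: add_ac)
  obtain a where a: "0 < a" "a < r"
    and ga: "g r - g 0 = (r - 0) * (?u (x + r *\<^sub>R v + a *\<^sub>R u) - ?u (x + a *\<^sub>R u))"
    using MVT2[OF r dg] by blast
  define k where "k b = ?u (x + a *\<^sub>R u + b *\<^sub>R v)" for b
  have dk: "(k has_real_derivative frechet_derivative ?u (at (x + a *\<^sub>R u + b *\<^sub>R v)) v) (at b)"
    if "0 \<le> b" "b \<le> r" for b
    unfolding k_def
    using that a mem[of a b] smooth_on_differentiable[OF smooth_on_frechet_derivative[OF f]]
    by (intro directional_derivative) auto
  obtain b where b: "0 < b" "b < r"
    and kb: "k r - k 0 = (r - 0) * frechet_derivative ?u (at (x + a *\<^sub>R u + b *\<^sub>R v)) v"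
    using MVT2[OF r dk] by blast
  have "f (x + r *\<^sub>R u + r *\<^sub>R v) - f (x + r *\<^sub>R u) - f (x + r *\<^sub>R v) + f x = g r - g 0"
    by (simp add: g_def algebra_simps)
  also have "\<dots> = r * (k r - k 0)"
    using ga by (simp add: k_def algebra_simps)
  also have "\<dots> = r\<^sup>2 * frechet_derivative ?u (at (x + a *\<^sub>R u + b *\<^sub>R v)) v"
    using kb by (simp add: power2_eq_square)
  finally show ?thesis using a b by (intro exI[of _ a] exI[of _ b]) auto
qed

text \<open>The second difference does not change when \<open>u\<close> and \<open>v\<close> are
  swapped, so both mixed derivatives take a common value at points of an arbitrarily small
  parallelogram at \<open>x\<close>. Both are continuous at \<open>x\<close>, hence agree there up
  to every positive error.\<close>

lemma second_derivative_symmetric: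
  fixes f :: "'a::real_normed_vector \<Rightarrow> real"
  assumes S: "open S" "x \<in> S" and f: "smooth_on S f"
  shows "frechet_derivative (\<lambda>z. frechet_derivative f (at z) u) (at x) v =
    frechet_derivative (\<lambda>z. frechet_derivative f (at z) v) (at x) u"
proof -
  define P where "P u v z = frechet_derivative (\<lambda>z. frechet_derivative f (at z) u) (at z) v"
    for u v z
  have cont: "isCont (P u v) x" for u v
    unfolding P_def using S f
    by (metis (no_types) continuous_on_eq_continuous_at smooth_on_continuous_on
        smooth_on_frechet_derivative)
  have "\<bar>P u v x - P v u x\<bar> \<le> e" if e: "0 < e" for e
  proof -
    have close: "\<forall>\<^sub>F z in nhds x. \<bar>P u v z - P u v x\<bar> < e/2" for u v
      using tendstoD[OF cont[of u v, unfolded continuous_at tendsto_at_iff_tendsto_nhds], of "e/2"] e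
      by (simp add: dist_real_def)
    have "\<forall>\<^sub>F z in nhds x. z \<in> S \<and> \<bar>P u v z - P u v x\<bar> < e/2 \<and> \<bar>P v u z - P v u x\<bar> < e/2"
      by (intro eventually_conj eventually_nhds_in_open close S)
    then obtain d where d: "0 < d"
      and D: "\<And>z. dist z x < d \<Longrightarrow> z \<in> S \<and> \<bar>P u v z - P u v x\<bar> < e/2 \<and> \<bar>P v u z - P v u x\<bar> < e/2"
      unfolding eventually_nhds_metric by blast
    \<comment> \<open>This size keeps the whole parallelogram within \<open>d/2\<close> of
      \<open>x\<close>. The summand 1 keeps the denominator positive when \<open>u\<close> and
      \<open>v\<close> are both 0.\<close>
    define r where "r = d / (2 * (norm u + norm v + 1))"
    have pos: "0 < norm u + norm v + 1" by (simp add: add_nonneg_pos)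
    have r: "0 < r" using d pos by (simp add: r_def)
    have near: "dist (x + a *\<^sub>R u + b *\<^sub>R v) x < d"
      if "0 \<le> a" "a \<le> r" "0 \<le> b" "b \<le> r" for a b
    proof -
      have "dist (x + a *\<^sub>R u + b *\<^sub>R v) x = norm (a *\<^sub>R u + b *\<^sub>R v)"
        by (simp add: dist_norm add.assoc)
      also have "\<dots> \<le> a * norm u + b * norm v"
        using norm_triangle_ineq[of "a *\<^sub>R u" "b *\<^sub>R v"] that by simp
      also have "\<dots> \<le> r * norm u + r * norm v"
        using that by (intro add_mono mult_right_mono) auto
      also have "\<dots> \<le> r * (norm u + norm v + 1)" using r by (simp add: algebra_simps)
      also have "\<dots> = d / 2" using pos by (simp add: r_def field_simps)
      also have "\<dots> < d" using d by simp
      finally show ?thesis .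
    qed
    obtain a b where ab: "0 \<le> a" "a \<le> r" "0 \<le> b" "b \<le> r"
      and 1: "f (x + r *\<^sub>R u + r *\<^sub>R v) - f (x + r *\<^sub>R u) - f (x + r *\<^sub>R v) + f x
        = r\<^sup>2 * P u v (x + a *\<^sub>R u + b *\<^sub>R v)"
      using second_difference_mvt[OF r _ f, of x u v] near D unfolding P_def by blast
    have near': "x + a *\<^sub>R v + b *\<^sub>R u \<in> S" if "0 \<le> a" "a \<le> r" "0 \<le> b" "b \<le> r" for a b
      using near[of b a] D that by (metis add.assoc add.commute)
    obtain a' b' where ab': "0 \<le> a'" "a' \<le> r" "0 \<le> b'" "b' \<le> r"
      and 2: "f (x + r *\<^sub>R v + r *\<^sub>R u) - f (x + r *\<^sub>R v) - f (x + r *\<^sub>R u) + f x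
        = r\<^sup>2 * P v u (x + a' *\<^sub>R v + b' *\<^sub>R u)"
      using second_difference_mvt[OF r near' f] unfolding P_def by blast
    \<comment> \<open>Both sides are the same second difference, expanded in the two orders of the
      directions.\<close>
    have "r\<^sup>2 * P u v (x + a *\<^sub>R u + b *\<^sub>R v) = r\<^sup>2 * P v u (x + b' *\<^sub>R u + a' *\<^sub>R v)"
      using 1 2 by (simp add: algebra_simps)
    then have "P u v (x + a *\<^sub>R u + b *\<^sub>R v) = P v u (x + b' *\<^sub>R u + a' *\<^sub>R v)"
      using r by simp
    then show ?thesis
      using D[OF near[of a b]] D[OF near[of b' a']] ab ab' by linarith
  qed
  then have "\<bar>P u v x - P v u x\<bar> \<le> 0"
    using field_le_epsilon[of "\<bar>P u v x - P v u x\<bar>" 0] by simp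
  then show ?thesis by (simp add: P_def)
qed

section \<open>Partial derivatives of \<sigma> and the differential of
  \<open>N_coeff\<close>\<close>

lemma smooth_on_partial: "smooth_on V s \<Longrightarrow> smooth_on V (partial i s)"
  unfolding partial_def[abs_def] by (rule smooth_on_frechet_derivative)

lemma partial2_commute:
  assumes "open V" "x \<in> V" "smooth_on V s"
  shows "partial2 i j s x = partial2 j i s x"
  using second_derivative_symmetric[OF assms] by (simp add: partial2_def partial_def[abs_def])

text \<open>By linearity the differential is determined by its values on the standard basis. The sum
  form can be evaluated on any tangent vector.\<close>

lemma has_derivative_partial_sum:
  fixes f :: "real^4 \<Rightarrow> real"
  assumes "f differentiable (at x)"
  shows "(f has_derivative (\<lambda>d. \<Sum>k\<in>UNIV. partial k f x * d $ k)) (at x)"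
proof -
  have D: "(f has_derivative frechet_derivative f (at x)) (at x)"
    using assms frechet_derivative_works by blast
  then have lin: "linear (frechet_derivative f (at x))"
    by (simp add: has_derivative_bounded_linear bounded_linear.linear)
  have "frechet_derivative f (at x) d = (\<Sum>k\<in>UNIV. partial k f x * d $ k)" for d
  proof -
    have "frechet_derivative f (at x) d = frechet_derivative f (at x) (\<Sum>k\<in>UNIV. d $ k *\<^sub>R axis k 1)"
      by (simp add: basis_expansion scalar_mult_eq_scaleR[symmetric])
    then show ?thesis
      by (simp add: linear_sum[OF lin] linear_scale[OF lin] partial_def mult.commute)
  qed
  then have "frechet_derivative f (at x) = (\<lambda>d. \<Sum>k\<in>UNIV. partial k f x * d $ k)" by blast
  then show ?thesis using D by simp
qed

lemma partial_has_derivative: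
  assumes "smooth_on V s" "x \<in> V"
  shows "(partial i s has_derivative (\<lambda>d. \<Sum>k\<in>UNIV. partial2 i k s x * d $ k)) (at x)"
  using has_derivative_partial_sum[OF smooth_on_differentiable[OF smooth_on_partial[OF assms(1)] assms(2)]]
  by (simp add: partial2_def)

lemma partial_divD:
  assumes "smooth_on V s" "x \<in> V"
  shows "partial k (divD s) x = (\<Sum>m\<in>UNIV. partial2 m k s x)"
proof -
  have "(divD s has_derivative (\<lambda>d. \<Sum>m\<in>UNIV. \<Sum>k\<in>UNIV. partial2 m k s x * d $ k)) (at x)"
    unfolding divD_def[abs_def] by (intro has_derivative_sum partial_has_derivative[OF assms])
  from frechet_derivative_at[OF this, symmetric] show ?thesis
    by (simp add: partial_def axis_def if_distrib[of "\<lambda>u. _ * u"] cong: if_cong)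
qed


text \<open>The differential of \<open>N_coeff s i j\<close>, with the base point first and the
  tangent vector second. Neither \<open>t\<close> nor \<open>dt\<close> enters the formula. Having
  it in closed form turns derivatives along adapted fields into substitutions.\<close>

definition dN_coeff :: "(real^4 \<Rightarrow> real) \<Rightarrow> 4 \<Rightarrow> 4 \<Rightarrow> jet \<Rightarrow> jet \<Rightarrow> real" where
  "dN_coeff s i j = (\<lambda>(t, x, y) (dt, dx, dy).
     (\<Sum>k\<in>UNIV. partial2 j k s x * dx $ k) * y $ i + partial j s x * dy $ i
     + (\<Sum>m\<in>UNIV. (\<Sum>k\<in>UNIV. partial2 m k s x * dx $ k) * y $ m + partial m s x * dy $ m) * kron i j
     + ((\<Sum>k\<in>UNIV. partial2 i k s x * dx $ k)
         - 1/3 * (\<Sum>m\<in>UNIV. \<Sum>k\<in>UNIV. partial2 m k s x * dx $ k)) * (S1 y - y $ j)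
     + (partial i s x - 1/3 * divD s x) * (S1 dy - dy $ j))"

lemma N_coeff_has_derivative:
  assumes "smooth_on V s" "x \<in> V"
  shows "(N_coeff s i j has_derivative dN_coeff s i j (t, x, y)) (at (t, x, y))"
proof -
  have px: "((\<lambda>q. partial i s (fst (snd q))) has_derivative
      (\<lambda>v. \<Sum>k\<in>UNIV. partial2 i k s x * fst (snd v) $ k)) (at (t, x, y))" for i
    using assms
    by (intro has_derivative_compose[where f = "\<lambda>q::jet. fst (snd q)"
          and g = "partial i s" and g' = "\<lambda>d. \<Sum>k\<in>UNIV. partial2 i k s x * d $ k"])
      (auto intro!: derivative_eq_intros partial_has_derivative)
  have yx: "((\<lambda>q::jet. snd (snd q) $ i) has_derivative (\<lambda>v. snd (snd v) $ i)) (at (t, x, y))" for i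
    by (auto intro!: derivative_eq_intros
        bounded_linear.has_derivative[OF bounded_linear_vec_nth])
  show ?thesis
    unfolding N_coeff_def dN_coeff_def divD_def S1_def case_prod_beta fst_conv snd_conv
    by (rule derivative_eq_intros px yx refl)+
      (simp add: fun_eq_iff algebra_simps sum.distrib)
qed

section \<open>Derivatives of the adapted fields\<close>

lemma sum_axis_nth:
  "(\<Sum>i\<in>UNIV. c i *\<^sub>R axis i (1::real)) $ l = c l"
  "(\<Sum>i\<in>UNIV. c i * axis i (1::real) $ l) = c l"
  "(\<Sum>i\<in>UNIV. axis i (1::real) $ l * c i) = c l"
  for l :: "'n::finite"
  by (simp_all add: axis_def if_distrib[of "\<lambda>u. _ * u"] if_distrib[of "\<lambda>u. u * _"] cong: if_cong)

lemma adapted_Time: "adapted h s Time = (\<lambda>(t, x, y). (1, 0, kappa h t *\<^sub>R y))"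
  by (auto simp: fun_eq_iff vec_eq_iff M_coeff_def sum_negf sum_axis_nth)

text \<open>The value of \<open>k'\<close>, the derivative of \<open>kappa h\<close>, is left open:
  it only multiplies \<open>dt\<close>, and the horizontal and vertical fields bracketed with this
  one have time component 0.\<close>

lemma adapted_Time_has_derivative:
  assumes h: "smooth_on UNIV h" and pos: "0 < h t"
  shows "\<exists>k'. (adapted h s Time has_derivative
    (\<lambda>(dt, dx, dy). (0, 0, (k' * dt) *\<^sub>R y + kappa h t *\<^sub>R dy))) (at (t, x, y))"
proof -
  \<comment> \<open>Writing \<open>deriv h\<close> as a directional derivative makes it smooth by
    the lemmas on \<open>smooth_on\<close>.\<close>
  have "deriv h = (\<lambda>t. frechet_derivative h (at t) 1)"
  proof
    fix t
    show "deriv h t = frechet_derivative h (at t) 1"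
      using smooth_on_differentiable[OF h, of t] DERIV_deriv_iff_real_differentiable[of h t]
        frechet_derivative_at[of h "(*) (deriv h t)" t]
      by (simp add: has_field_derivative_def) (metis mult.right_neutral)
  qed
  then have "deriv h differentiable (at t)"
    using smooth_on_differentiable[OF smooth_on_frechet_derivative[OF h]] by auto
  then have "kappa h differentiable (at t)"
    unfolding kappa_def[abs_def] using smooth_on_differentiable[OF h] pos
    by (intro derivative_intros) auto
  then obtain k' where k: "(kappa h has_derivative (\<lambda>u. k' * u)) (at t)"
    unfolding real_differentiable_def has_field_derivative_def by blast
  have "((\<lambda>q::jet. kappa h (fst q)) has_derivative (\<lambda>v. k' * fst v)) (at (t, x, y))"
    using k by (intro has_derivative_compose[where f = "fst::jet \<Rightarrow> real" and g' = "\<lambda>u. k' * u"])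
      (auto intro!: derivative_eq_intros)
  then have "(adapted h s Time has_derivative
    (\<lambda>(dt, dx, dy). (0, 0, (k' * dt) *\<^sub>R y + kappa h t *\<^sub>R dy))) (at (t, x, y))"
    unfolding adapted_Time case_prod_beta
    by (auto intro!: derivative_eq_intros simp: add.commute)
  then show ?thesis by blast
qed

lemma adapted_Horiz_has_derivative:
  assumes "smooth_on V s" "x \<in> V"
  shows "(adapted h s (Horiz j) has_derivative
    (\<lambda>v. (0, 0, - (\<Sum>i\<in>UNIV. dN_coeff s i j (t, x, y) v *\<^sub>R axis i 1)))) (at (t, x, y))"
proof -
  have "adapted h s (Horiz j) = (\<lambda>p. (0, axis j 1, - (\<Sum>i\<in>UNIV. N_coeff s i j p *\<^sub>R axis i 1)))"
    by (simp add: fun_eq_iff)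
  then show ?thesis
    by (auto intro!: derivative_eq_intros N_coeff_has_derivative[OF assms])
qed

lemma adapted_Vert_has_derivative: "(adapted h s (Vert j) has_derivative (\<lambda>v. 0)) (at p)"
proof -
  have "adapted h s (Vert j) = (\<lambda>p. (0, 0, axis j 1))"
    by (simp add: fun_eq_iff)
  then show ?thesis by (simp add: zero_prod_def[symmetric])
qed

section \<open>Torsion on pairs of adapted fields\<close>

lemma lie_bracket_eq:
  assumes "(X has_derivative X') (at p)" "(Y has_derivative Y') (at p)"
  shows "lie_bracket X Y p = Y' (X p) - X' (Y p)"
  using assms by (simp add: lie_bracket_def frechet_derivative_at[symmetric])

lemma torsion_antisym: "torsion h s X Y p = - torsion h s Y X p"
  by (simp add: torsion_def lie_bracket_def)

text \<open>Both covariant derivatives are 0, so only the bracket matters. Its components are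
  \<open>- kappa h t\<close> times the derivative of N along \<open>y\<close>, plus
  \<open>kappa h t\<close> times N; these cancel by Euler's identity for homogeneity of degree
  one.\<close>

lemma torsion_Time_Horiz:
  assumes h: "smooth_on UNIV h" "0 < h t" and s: "smooth_on V s" "x \<in> V"
  shows "torsion h s (adapted h s Time) (adapted h s (Horiz j)) (t, x, y) = 0"
proof -
  obtain k' where k: "(adapted h s Time has_derivative
    (\<lambda>(dt, dx, dy). (0, 0, (k' * dt) *\<^sub>R y + kappa h t *\<^sub>R dy))) (at (t, x, y))"
    using adapted_Time_has_derivative[OF h] by blast
  show ?thesis
    unfolding torsion_def nabla_adapted lie_bracket_eq[OF k adapted_Horiz_has_derivative[OF s]]
    by (auto simp: prod_eq_iff vec_eq_iff sum_axis_nth dN_coeff_def N_coeff_def adapted_Time S1_def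
        sum_distrib_left algebra_simps simp del: adapted.simps(1))
qed

text \<open>The bracket equals \<open>- kappa h t\<close> times the vertical field, which is exactly
  the covariant derivative of that field along \<open>Time\<close>.\<close>

lemma torsion_Time_Vert:
  assumes h: "smooth_on UNIV h" "0 < h t"
  shows "torsion h s (adapted h s Time) (adapted h s (Vert j)) (t, x, y) = 0"
proof -
  obtain k' where k: "(adapted h s Time has_derivative
    (\<lambda>(dt, dx, dy). (0, 0, (k' * dt) *\<^sub>R y + kappa h t *\<^sub>R dy))) (at (t, x, y))"
    using adapted_Time_has_derivative[OF h] by blast
  show ?thesis
    by (simp add: torsion_def nabla_adapted lie_bracket_eq[OF k adapted_Vert_has_derivative]
        prod_eq_iff vec_eq_iff)
qed

lemma torsion_Vert_Vert: "torsion h s (adapted h s (Vert i)) (adapted h s (Vert j)) p = 0"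
  by (simp add: torsion_def nabla_adapted
      lie_bracket_eq[OF adapted_Vert_has_derivative adapted_Vert_has_derivative])

lemma sum_kron: "(\<Sum>p\<in>UNIV. kron p j * f p) = f j" "(\<Sum>p\<in>UNIV. kron j p * f p) = f j"
  "(\<Sum>p\<in>UNIV. f p * kron p j) = f j" "(\<Sum>p\<in>UNIV. f p * kron j p) = f j"
  for j :: "'n::finite"
  by (simp_all add: kron_def if_distrib[of "\<lambda>u. _ * u"] if_distrib[of "\<lambda>u. u * _"] cong: if_cong)

lemma torsion_Horiz_Vert:
  assumes s: "smooth_on V s" "x \<in> V"
  shows "torsion h s (adapted h s (Horiz k)) (adapted h s (Vert j)) (t, x, y) = 0"
proof -
  \<comment> \<open>The vertical derivative of N is L, so the bracket equals the covariant
    derivative of the vertical field.\<close>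
  have "dN_coeff s i k (t, x, y) (0, 0, axis j 1) = L_coeff s i j k (t, x, y)" for i
    by (simp add: dN_coeff_def L_coeff_def S1_def axis_def kron_def if_distrib[of "\<lambda>u. _ * u"]
        algebra_simps cong: if_cong)
  then show ?thesis
    by (simp add: torsion_def nabla_adapted
        lie_bracket_eq[OF adapted_Horiz_has_derivative[OF s] adapted_Vert_has_derivative]
        prod_eq_iff vec_eq_iff sum_axis_nth fst_sum snd_sum)
qed

lemma L_coeff_commute: "L_coeff s i j k = L_coeff s i k j"
  by (auto simp: L_coeff_def kron_def fun_eq_iff)

text \<open>The covariant terms cancel by \<open>L_coeff_commute\<close>, leaving minus the bracket.
  The minus sign in the definition of the horizontal fields then makes the term with lower index
  \<open>j\<close> positive.\<close>

lemma torsion_Horiz_Horiz: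
  fixes t :: real and x y :: "real^4"
  assumes s: "smooth_on V s" "x \<in> V"
  defines "p \<equiv> (t, x, y)"
  shows "torsion h s (adapted h s (Horiz k)) (adapted h s (Horiz j)) p =
    (0, 0, \<Sum>i\<in>UNIV. (dN_coeff s i j p (adapted h s (Horiz k) p)
      - dN_coeff s i k p (adapted h s (Horiz j) p)) *\<^sub>R axis i 1)"
  unfolding p_def
  by (simp add: torsion_def nabla_adapted L_coeff_commute[of s _ j k]
      lie_bracket_eq[OF adapted_Horiz_has_derivative[OF s] adapted_Horiz_has_derivative[OF s]]
      prod_eq_iff vec_eq_iff sum_axis_nth del: adapted.simps)

section \<open>The curvature component R and its comparison with \<open>frakR\<close>\<close>

lemma N_coeff_contractions:
  "(\<Sum>p\<in>UNIV. N_coeff s p k (t, x, y)) =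
    partial k s x * S1 y + (\<Sum>m\<in>UNIV. partial m s x * y $ m) - 1/3 * divD s x * (S1 y - y $ k)"
  "(\<Sum>p\<in>UNIV. partial p s x * N_coeff s p k (t, x, y)) =
    2 * partial k s x * (\<Sum>m\<in>UNIV. partial m s x * y $ m)
    + (grad_norm2 s x - 1/3 * (divD s x)\<^sup>2) * (S1 y - y $ k)"
proof -
  define q where "q = (\<Sum>m\<in>UNIV. partial m s x * y $ m)"
  have N: "N_coeff s p k (t, x, y) = partial k s x * y $ p + q * kron p k
      + (partial p s x - 1/3 * divD s x) * (S1 y - y $ k)" for p
    by (simp add: N_coeff_def q_def)
  have kron1: "(\<Sum>p\<in>UNIV. kron p k) = 1"
    using sum_kron(1)[of k "\<lambda>_. 1"] by simp
  \<comment> \<open>The dimension enters here: summing \<open>1/3 * divD s x\<close> over four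
    indices gives \<open>4/3 * divD s x\<close>.\<close>
  have "(\<Sum>p\<in>UNIV. N_coeff s p k (t, x, y)) =
    partial k s x * S1 y + q * (\<Sum>p\<in>UNIV. kron p k)
    + (divD s x - 4/3 * divD s x) * (S1 y - y $ k)"
    unfolding N sum.distrib sum_distrib_left[symmetric] sum_distrib_right[symmetric] sum_subtractf
    by (simp add: S1_def divD_def)
  then show "(\<Sum>p\<in>UNIV. N_coeff s p k (t, x, y)) =
    partial k s x * S1 y + (\<Sum>m\<in>UNIV. partial m s x * y $ m) - 1/3 * divD s x * (S1 y - y $ k)"
    by (simp add: kron1 q_def algebra_simps)
  \<comment> \<open>The squares add up to \<open>grad_norm2\<close>. The first term and the
    Kronecker term each contribute \<open>partial k s x * q\<close>, whence the factor 2.\<close>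
  have "partial p s x * N_coeff s p k (t, x, y) = partial k s x * (partial p s x * y $ p)
      + q * (partial p s x * kron p k)
      + ((partial p s x)\<^sup>2 - 1/3 * divD s x * partial p s x) * (S1 y - y $ k)" for p
    by (simp add: N algebra_simps power2_eq_square)
  then have "(\<Sum>p\<in>UNIV. partial p s x * N_coeff s p k (t, x, y)) = partial k s x * q
      + q * (\<Sum>p\<in>UNIV. partial p s x * kron p k)
      + (grad_norm2 s x - 1/3 * divD s x * divD s x) * (S1 y - y $ k)"
    by (simp add: sum.distrib sum_distrib_left[symmetric] sum_distrib_right[symmetric] sum_subtractf
        sum_divide_distrib[symmetric] grad_norm2_def divD_def q_def)
  then show "(\<Sum>p\<in>UNIV. partial p s x * N_coeff s p k (t, x, y)) =
    2 * partial k s x * (\<Sum>m\<in>UNIV. partial m s x * y $ m)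
    + (grad_norm2 s x - 1/3 * (divD s x)\<^sup>2) * (S1 y - y $ k)"
    by (simp add: sum_kron q_def[symmetric] power2_eq_square)
qed

text \<open>Substitutes \<open>dx = axis k 1\<close> and \<open>dy = - N\<close> with lower index
  \<open>k\<close>. The first yields the terms with second derivatives of \<sigma>, the second those
  quadratic in its first derivatives.\<close>

lemma dN_coeff_adapted_Horiz:
  fixes t :: real and x y :: "real^4"
  assumes s: "smooth_on V s" "x \<in> V"
  defines "p \<equiv> (t, x, y)"
  shows "dN_coeff s l j p (adapted h s (Horiz k) p) =
    partial2 j k s x * y $ l + (\<Sum>m\<in>UNIV. partial2 m k s x * y $ m) * kron l j
    + (partial2 l k s x - 1/3 * partial k (divD s) x) * (S1 y - y $ j)
    - partial j s x * N_coeff s l k p - (\<Sum>m\<in>UNIV. partial m s x * N_coeff s m k p) * kron l j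
    - (partial l s x - 1/3 * divD s x) * ((\<Sum>m\<in>UNIV. N_coeff s m k p) - N_coeff s j k p)"
proof -
  have ax: "(\<Sum>m\<in>UNIV. partial2 i m s x * axis k 1 $ m) = partial2 i k s x" for i
    by (simp add: axis_def if_distrib[of "\<lambda>u. _ * u"] cong: if_cong)
  show ?thesis
    by (simp add: p_def dN_coeff_def ax sum_axis_nth S1_def[of "- _"] partial_divD[OF s] sum.distrib
        sum_negf sum_subtractf algebra_simps diff_divide_distrib)
qed

text \<open>Contraction with \<open>y\<close> turns each factor \<open>1 - kron p j\<close> into
  \<open>S1 y - y $ j\<close>, the same quantity that occurs in \<open>N_coeff\<close>.\<close>

lemma sum_frakR:
  "(\<Sum>p\<in>UNIV. frakR s l p j k x * y $ p) =
    kron l j * ((\<Sum>m\<in>UNIV. partial2 m k s x * y $ m) - partial k s x * (\<Sum>m\<in>UNIV. partial m s x * y $ m))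
    - kron l k * ((\<Sum>m\<in>UNIV. partial2 m j s x * y $ m) - partial j s x * (\<Sum>m\<in>UNIV. partial m s x * y $ m))
    + (S1 y - y $ j) * (partial2 l k s x - partial l s x * partial k s x)
    - (S1 y - y $ k) * (partial2 l j s x - partial l s x * partial j s x)
    + 1/3 * divD s x * (partial k s x * (S1 y - y $ j) - partial j s x * (S1 y - y $ k))
    + (grad_norm2 s x - 1/3 * (divD s x)\<^sup>2) * (kron l k * (S1 y - y $ j) - kron l j * (S1 y - y $ k))
    + 1/3 * (partial j (divD s) x * (S1 y - y $ k) - partial k (divD s) x * (S1 y - y $ j))"
proof -
  \<comment> \<open>\<open>A\<close> and \<open>B\<close> collect the coefficients of
    \<open>1 - kron p j\<close> and \<open>1 - kron p k\<close> in all lines of \<open>frakR\<close>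
    but the first; \<open>C\<close> is the contraction of that first line. Exchanging
    \<open>j\<close> and \<open>k\<close> exchanges \<open>A\<close> and \<open>B\<close>.\<close>
  define A B C where "A = partial2 l k s x - partial l s x * partial k s x
      + 1/3 * divD s x * partial k s x
      + (grad_norm2 s x - 1/3 * (divD s x)\<^sup>2) * kron l k - 1/3 * partial k (divD s) x"
    and "B = partial2 l j s x - partial l s x * partial j s x
      + 1/3 * divD s x * partial j s x
      + (grad_norm2 s x - 1/3 * (divD s x)\<^sup>2) * kron l j - 1/3 * partial j (divD s) x"
    and "C = (\<lambda>k. (\<Sum>m\<in>UNIV. partial2 m k s x * y $ m)
      - partial k s x * (\<Sum>m\<in>UNIV. partial m s x * y $ m))"
  have "frakR s l p j k x * y $ p =
      kron l j * (partial2 p k s x * y $ p - partial k s x * (partial p s x * y $ p))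
    - kron l k * (partial2 p j s x * y $ p - partial j s x * (partial p s x * y $ p))
    + A * (y $ p - kron p j * y $ p) - B * (y $ p - kron p k * y $ p)" for p
    unfolding frakR_def A_def B_def
    by (simp add: algebra_simps add_divide_distrib diff_divide_distrib)
  then have "(\<Sum>p\<in>UNIV. frakR s l p j k x * y $ p) =
    kron l j * C k - kron l k * C j + A * (S1 y - y $ j) - B * (S1 y - y $ k)"
    by (simp add: sum.distrib sum_subtractf sum_distrib_left[symmetric] sum_kron C_def S1_def)
  then show ?thesis
    by (simp add: A_def B_def C_def field_simps)
qed

lemma coadapted_zero: "coadapted h s c p 0 = 0"
  by (cases c) auto

lemma R_torsion_eq:
  assumes V: "open V" "x \<in> V" and s: "smooth_on V s"
  shows "R_torsion h s l j k (t, x, y) = (\<Sum>p\<in>UNIV. frakR s l p j k x * y $ p)"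
proof -
  let ?p = "(t, x, y)"
  define q where "q = (\<Sum>m\<in>UNIV. partial m s x * y $ m)"
  have N: "N_coeff s i j ?p = partial j s x * y $ i + q * kron i j
      + (partial i s x - 1/3 * divD s x) * (S1 y - y $ j)" for i j
    by (simp add: N_coeff_def q_def)
  \<comment> \<open>Needed to cancel the two terms in which a second derivative multiplies
    \<open>y $ l\<close>; they do not occur in \<open>sum_frakR\<close>.\<close>
  have sym: "partial2 k j s x = partial2 j k s x"
    using partial2_commute[OF V s] .
  have "R_torsion h s l j k ?p = dN_coeff s l j ?p (adapted h s (Horiz k) ?p)
      - dN_coeff s l k ?p (adapted h s (Horiz j) ?p)"
    by (simp add: R_torsion_def torsion_comp_def torsion_Horiz_Horiz[OF s V(2)] sum_axis_nth
        del: adapted.simps)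
  also have "\<dots> = (\<Sum>p\<in>UNIV. frakR s l p j k x * y $ p)"
    unfolding sum_frakR dN_coeff_adapted_Horiz[OF s V(2)] N_coeff_contractions sym
    unfolding N q_def[symmetric]
    \<comment> \<open>Once N is expanded, Kronecker symbols occur only between \<open>l\<close>,
      \<open>j\<close> and \<open>k\<close>; fixing their equalities leaves a polynomial
      identity.\<close>
    by (cases "l = j"; cases "l = k"; cases "j = k")
      (simp_all add: kron_def field_simps power2_eq_square)
  finally show ?thesis .
qed

lemma torsion_comp_eq_0:
  assumes h: "smooth_on UNIV h" "0 < h t" and s: "smooth_on V s" "x \<in> V"
    and abc: "\<not> (\<exists>j k l. a = Horiz k \<and> b = Horiz j \<and> c = Vert l)"
  shows "torsion_comp h s c a b (t, x, y) = 0"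
proof (cases "\<exists>j k. a = Horiz k \<and> b = Horiz j")
  case True
  then show ?thesis
    using abc by (cases c) (auto simp: torsion_comp_def torsion_Horiz_Horiz[OF s])
next
  case False
  have anti: "torsion h s (adapted h s a) (adapted h s b) (t, x, y) = 0"
    if "torsion h s (adapted h s b) (adapted h s a) (t, x, y) = 0" for a b
    using that torsion_antisym[of h s "adapted h s a"] by simp
  \<comment> \<open>Antisymmetry reduces the remaining pairs to those computed above and this
    diagonal one.\<close>
  have "torsion h s (adapted h s Time) (adapted h s Time) (t, x, y) = 0"
    by (simp add: torsion_def lie_bracket_def)
  with False have "torsion h s (adapted h s a) (adapted h s b) (t, x, y) = 0"
    by (cases a; cases b)
      (auto simp: torsion_Time_Horiz[OF h s] torsion_Time_Vert[OF h] torsion_Horiz_Vert[OF s]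
        torsion_Vert_Vert simp del: adapted.simps intro: anti)
  then show ?thesis by (simp add: torsion_comp_def coadapted_zero)
qed

section \<open>Effectiveness of R\<close>

lemma R_torsion_coordinate_nonzero:
  assumes V: "open V" "x \<in> V"
  shows "R_torsion h (\<lambda>x. x $ 1) 2 2 3 (t, x, 1) \<noteq> 0"
proof -
  let ?s = "\<lambda>x::real^4. x $ 1"
  have lin: "bounded_linear ?s" by (rule bounded_linear_vec_nth)
  have p: "partial i ?s = (\<lambda>_. kron i 1)" for i
    using frechet_derivative_at[OF bounded_linear_imp_has_derivative[OF lin], symmetric]
    by (auto simp: partial_def axis_def kron_def)
  have c: "partial i (\<lambda>_. c) = (\<lambda>_. 0)" for i c
    by (simp add: partial_def fun_eq_iff frechet_derivative_const)
  have d: "divD ?s = (\<lambda>_. 1)"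
    by (simp add: divD_def p sum_4 kron_def fun_eq_iff)
  show ?thesis
    \<comment> \<open>Second derivatives vanish, and so do the first derivatives with indices 2 and
      3. Only the bracket \<open>grad_norm2 - 1/3 * divD\<^sup>2 = 2/3\<close> survives, with factor
      \<open>-3\<close>, so the value is \<open>-2\<close>.\<close>
    unfolding R_torsion_eq[OF V smooth_on_bounded_linear[OF lin]] sum_frakR
    by (simp add: partial2_def p c d grad_norm2_def sum_4 kron_def S1_def)
qed

lemma nonconstant_on_coordinate:
  fixes V :: "(real^'n) set"
  assumes "open V" "V \<noteq> {}"
  shows "nonconstant_on V (\<lambda>x. x $ i)"
proof -
  obtain x where x: "x \<in> V" using assms by blast
  then obtain e where e: "0 < e" "ball x e \<subseteq> V" using assms open_contains_ball by blast
  have "x + (e/2) *\<^sub>R axis i 1 \<in> V"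
    using e by (intro subsetD[OF e(2)]) (simp add: dist_norm norm_axis_1)
  then show ?thesis
    unfolding nonconstant_on_def using x e
    by (intro bexI[of _ x] bexI[of _ "x + (e/2) *\<^sub>R axis i 1"]) (auto simp: axis_def)
qed

theorem proposition3p2:
  fixes h :: "real \<Rightarrow> real"
    and A :: "'m::{t2_space, second_countable_topology} chart set"
    and U :: "'m set" and \<phi> :: "'m \<Rightarrow> real^4"
    and \<sigma> :: "'m \<Rightarrow> real"
    and V :: "(real^4) set" and s :: "real^4 \<Rightarrow> real"
  assumes h_smooth: "smooth_on UNIV h" and h_pos: "\<And>t. 0 < h t"
    and atlas: "smooth_atlas A"
    and chart: "(U, \<phi>) \<in> A" "U \<noteq> {}"
    and sigma_smooth: "smooth_function A \<sigma>" and sigma_nonconst: "nonconstant_on UNIV \<sigma>"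
  defines "V \<equiv> \<phi> ` U" and "s \<equiv> \<sigma> \<circ> inv_into U \<phi>"
  shows
    \<comment> \<open>the torsion component \<open>R\<close>\<close>
    "(\<forall>t x y l j k. (t, x, y) \<in> jet_region V \<longrightarrow>
        R_torsion h s l j k (t, x, y) = (\<Sum>p\<in>UNIV. frakR s l p j k x * y $ p))
    \<comment> \<open>all other adapted components vanish\<close>
    \<and> (\<forall>P \<in> jet_region V. \<forall>a b c.
        \<not> (\<exists>j k l. a = Horiz k \<and> b = Horiz j \<and> c = Vert l) \<longrightarrow> torsion_comp h s c a b P = 0)
    \<comment> \<open>\<open>R\<close> is effective: it does not vanish automatically\<close>
    \<and> (\<exists>s'. smooth_on V s' \<and> nonconstant_on V s' \<and>
        (\<exists>P \<in> metric_domain V. \<exists>l j k. R_torsion h s' l j k P \<noteq> 0))"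
proof -
  have V: "open V" "V \<noteq> {}"
    using atlas chart by (auto simp: smooth_atlas_def is_chart_def V_def)
  have s: "smooth_on V s"
    using sigma_smooth chart(1) by (auto simp: smooth_function_def V_def s_def)
  have R: "R_torsion h s l j k (t, x, y) = (\<Sum>p\<in>UNIV. frakR s l p j k x * y $ p)"
    if "(t, x, y) \<in> jet_region V" for t x y l j k
    using that V(1) s by (intro R_torsion_eq) (auto simp: jet_region_def)
  have zero: "torsion_comp h s c a b P = 0"
    if "P \<in> jet_region V" "\<not> (\<exists>j k l. a = Horiz k \<and> b = Horiz j \<and> c = Vert l)" for P a b c
    using that torsion_comp_eq_0[OF h_smooth h_pos s] by (auto simp: jet_region_def)
  obtain x where x: "x \<in> V" using V(2) by blast
  \<comment> \<open>At the vector with all entries 1, \<open>G11\<close> equals 6, so the witness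
    lies where the metric is defined.\<close>
  have "(0, x, 1) \<in> metric_domain V"
    using x by (simp add: metric_domain_def jet_region_def G11_def)
  then have "\<exists>s'. smooth_on V s' \<and> nonconstant_on V s' \<and>
      (\<exists>P\<in>metric_domain V. \<exists>l j k. R_torsion h s' l j k P \<noteq> 0)"
    using R_torsion_coordinate_nonzero[OF V(1) x] nonconstant_on_coordinate[OF V]
      smooth_on_bounded_linear[OF bounded_linear_vec_nth] by blast
  with R zero show ?thesis by blast
qed

end
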